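(* For an $m$-ary recursive tree with highest label $n$, let $D_n$ be the depth of a node labeled $n$. Then, as $n\to\infty$, we have the convergence $$\frac{D_n-\ln(n)}{\sqrt{\ln(n)}}\ \longrightarrow\ \mathcal N(0,1)\quad\text{in distribution}.$$ The convergence occurs at the rate of $1/\sqrt{\ln(n)}$.
   Context: Fix an integer $m\ge 1$. The $m$-ary recursive tree grows as follows. It starts as a single root node labeled $1$. For each $n\ge 1$, given the tree with highest label $n$ (which has $m(n-1)+1$ nodes), one of its nodes is selected uniformly at random, and $m$ new nodes, all receiving the label $n+1$, are attached as children of the selected node. The depth of a node is its edge distance to the root; all nodes labeled $n$ have the same depth, denoted $D_n$. $\mathcal N(0,1)$ is the standard normal distribution. *)

theory Defs
  imports "HOL-Probability.Probability" "HOL-Library.Landau_Symbols"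
begin

text \<open>
  A node is a pair of its label and an index that distinguishes the \<open>m\<close> nodes sharing
  a label \<open>\<ge> 2\<close>. A tree is the set of its (parent, child) pairs; its set of nodes is
  determined by the arity \<open>m\<close> and the highest label.
\<close>

type_synonym node = "nat \<times> nat"

definition root_node :: node where
  "root_node = (1, 0)"

definition tree_nodes :: "nat \<Rightarrow> nat \<Rightarrow> node set" where
  "tree_nodes m n = insert root_node ({2..n} \<times> {..<m})"

definition attach :: "nat \<Rightarrow> nat \<Rightarrow> node \<Rightarrow> node rel \<Rightarrow> node rel" where
  "attach m l v E = E \<union> {v} \<times> ({l} \<times> {..<m})"

text \<open>
  The law of the tree with highest label \<open>n\<close>. Labels start at \<open>1\<close>, so the value at
  \<open>n = 0\<close> has no meaning.
\<close>

fun recursive_tree :: "nat \<Rightarrow> nat \<Rightarrow> node rel pmf" where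
  "recursive_tree m 0 = return_pmf {}"
| "recursive_tree m (Suc 0) = return_pmf {}"
| "recursive_tree m (Suc (Suc k)) =
     bind_pmf (recursive_tree m (Suc k)) (\<lambda>E.
     bind_pmf (pmf_of_set (tree_nodes m (Suc k))) (\<lambda>v.
     return_pmf (attach m (Suc (Suc k)) v E)))"

definition depth :: "node rel \<Rightarrow> node \<Rightarrow> nat" where
  "depth E v = (LEAST d. (root_node, v) \<in> (E \<union> E\<inverse>) ^^ d)"

text \<open>
  All nodes with label \<open>n\<close> have the same depth (lemma \<open>depth_same_label\<close> below), so the
  one with index \<open>0\<close> serves as representative; for \<open>n = 1\<close> it is the root.
\<close>

definition label_depth :: "nat \<Rightarrow> node rel \<Rightarrow> nat" where
  "label_depth n E = depth E (n, 0)"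

definition normalized_depth_law :: "nat \<Rightarrow> nat \<Rightarrow> real measure" where
  "normalized_depth_law m n =
     distr (measure_pmf (recursive_tree m n)) borel
       (\<lambda>E. (real (label_depth n E) - ln (real n)) / sqrt (ln (real n)))"

definition kolmogorov_dist :: "real measure \<Rightarrow> real measure \<Rightarrow> real" where
  "kolmogorov_dist M N = (SUP x. \<bar>cdf M x - cdf N x\<bar>)"

lemma finite_tree_nodes [simp]: "finite (tree_nodes m n)"
  by (simp add: tree_nodes_def)

lemma tree_nodes_nonempty [simp]: "tree_nodes m n \<noteq> {}"
  by (simp add: tree_nodes_def)

lemma card_tree_nodes: "card (tree_nodes m n) = m * (n - 1) + 1"
  by (simp add: tree_nodes_def root_node_def card_cartesian_product)

lemma recursive_tree_subset:
  assumes "E \<in> set_pmf (recursive_tree m n)"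
  shows "E \<subseteq> tree_nodes m n \<times> tree_nodes m n"
  using assms
proof (induction m n arbitrary: E rule: recursive_tree.induct)
  case (3 m k)
  then obtain E' v where E': "E' \<in> set_pmf (recursive_tree m (Suc k))"
    and v: "v \<in> tree_nodes m (Suc k)" and E: "E = attach m (Suc (Suc k)) v E'"
    by (auto simp: set_bind_pmf)
  have mono: "tree_nodes m (Suc k) \<subseteq> tree_nodes m (Suc (Suc k))"
    by (auto simp: tree_nodes_def)
  have new: "{Suc (Suc k)} \<times> {..<m} \<subseteq> tree_nodes m (Suc (Suc k))"
    by (auto simp: tree_nodes_def)
  show ?case
    unfolding E attach_def using "3.IH"[OF E'] v mono new by blast
qed simp_all

lemma depth_exists:
  assumes "E \<in> set_pmf (recursive_tree m n)" "n \<ge> 1" "u \<in> tree_nodes m n"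
  shows "\<exists>d. (root_node, u) \<in> (E \<union> E\<inverse>) ^^ d"
proof -
  have "(root_node, u) \<in> (E \<union> E\<inverse>)\<^sup>*"
    using assms
  proof (induction m n arbitrary: E u rule: recursive_tree.induct)
    case (3 m k)
    then obtain E' v where E': "E' \<in> set_pmf (recursive_tree m (Suc k))"
      and v: "v \<in> tree_nodes m (Suc k)" and E: "E = attach m (Suc (Suc k)) v E'"
      by (auto simp: set_bind_pmf)
    have sub: "(E' \<union> E'\<inverse>)\<^sup>* \<subseteq> (E \<union> E\<inverse>)\<^sup>*"
      by (rule rtrancl_mono) (auto simp: E attach_def)
    have old: "(root_node, w) \<in> (E \<union> E\<inverse>)\<^sup>*" if "w \<in> tree_nodes m (Suc k)" for w
      using "3.IH"[OF E' _ that] sub by auto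
    show ?case
    proof (cases "u \<in> tree_nodes m (Suc k)")
      case False
      then have "u \<in> {Suc (Suc k)} \<times> {..<m}"
        using "3.prems"(3) by (auto simp: tree_nodes_def le_Suc_eq)
      then have "(v, u) \<in> E \<union> E\<inverse>"
        by (auto simp: E attach_def)
      with old[OF v] show ?thesis
        by (rule rtrancl_into_rtrancl)
    qed (rule old)
  qed (auto simp: tree_nodes_def)
  then show ?thesis
    by (simp add: rtrancl_power)
qed

lemma depth_same_label:
  assumes E: "E \<in> set_pmf (recursive_tree m n)" and "n \<ge> 1"
    and u: "(n, i) \<in> tree_nodes m n"
  shows "depth E (n, i) = label_depth n E"
proof (cases "n = 1")
  case True
  with u show ?thesis
    by (auto simp: tree_nodes_def root_node_def label_depth_def)
next
  case False
  with \<open>n \<ge> 1\<close> obtain k where n: "n = Suc (Suc k)"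
    by (metis One_nat_def Suc_le_D not0_implies_Suc)
  with E obtain E' v where E': "E' \<in> set_pmf (recursive_tree m (Suc k))"
    and v: "v \<in> tree_nodes m (Suc k)" and E_eq: "E = attach m n v E'"
    by (auto simp: set_bind_pmf)
  have i: "i < m" "0 < m"
    using u n by (auto simp: tree_nodes_def root_node_def)
  have notin: "(n, j) \<notin> tree_nodes m (Suc k)" for j
    by (auto simp: tree_nodes_def root_node_def n)
  have nbr: "(w, (n, j)) \<in> E \<union> E\<inverse> \<longleftrightarrow> w = v" if "j < m" for w j
    using recursive_tree_subset[OF E'] notin[of j] v that
    unfolding E_eq attach_def by auto
  have "(root_node, (n, i)) \<in> (E \<union> E\<inverse>) ^^ d \<longleftrightarrow> (root_node, (n, 0)) \<in> (E \<union> E\<inverse>) ^^ d" for d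
  proof (cases d)
    case 0
    then show ?thesis by (simp add: root_node_def n)
  next
    case (Suc d')
    have "(root_node, (n, j)) \<in> (E \<union> E\<inverse>) ^^ d \<longleftrightarrow> (root_node, v) \<in> (E \<union> E\<inverse>) ^^ d'" if "j < m" for j
      by (cases v) (auto simp: Suc relcomp_unfold nbr[OF that, unfolded Un_iff converse_iff])
    with i show ?thesis by blast
  qed
  then show ?thesis
    by (simp add: depth_def label_depth_def)
qed

end

theory Submission
  imports Defs "HOL-Real_Asymp.Real_Asymp"
begin

text \<open>
  Passing from label \<open>n\<close> to \<open>n + 1\<close>, a uniformly random node of the new tree is with probability
  \<open>m / (m * n + 1)\<close> a new node, i.e. a child of a uniformly random old node, and otherwise a uniformly
  random old node. Hence the depth of a random node is a sum of independent Bernoulli variables with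
  these parameters, and \<open>D\<^sub>n - 1\<close> has this law for the tree with highest label \<open>n - 1\<close>. Mean and
  variance are both \<open>ln n + O(1)\<close>, and Stein's method gives the normal approximation: for a sum of
  independent Bernoulli variables the zero-bias coupling moves the sum by at most one unit, so no
  concentration inequality is needed to obtain the error \<open>O(1 / sqrt (ln n))\<close> in Kolmogorov distance.
\<close>

section \<open>The standard normal distribution\<close>

abbreviation std_normal_cdf :: "real \<Rightarrow> real" where
  "std_normal_cdf \<equiv> cdf std_normal_distribution"

interpretation std_normal: real_distribution std_normal_distribution
  by (rule real_dist_normal_dist)

lemma std_normal_cdf_diff:
  assumes "a < b"
  shows "std_normal_cdf b - std_normal_cdf a = integral {a..b} std_normal_density"
proof -
  have "std_normal_cdf b - std_normal_cdf a = measure std_normal_distribution {a<..b}"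
    by (rule std_normal.cdf_diff_eq[OF assms])
  also have "\<dots> = (\<integral>x. indicator {a<..b} x \<partial>std_normal_distribution)"
    by simp
  also have "\<dots> = (LINT x:{a<..b}|lborel. std_normal_density x)"
    unfolding set_lebesgue_integral_def
    by (subst integral_density) (auto simp: mult.commute)
  also have "\<dots> = integral {a<..b} std_normal_density"
    by (intro set_borel_integral_eq_integral, unfold set_integrable_def,
        rule integrable_mult_indicator) auto
  also have "\<dots> = integral {a..b} std_normal_density"
    by (intro integral_spike_set negligible_subset[OF negligible_sing[of a]]) auto
  finally show ?thesis .
qed

lemma std_normal_density_deriv:
  "(std_normal_density has_real_derivative - x * std_normal_density x) (at x)"
proof -
  have "((\<lambda>x. 1 / sqrt (2 * pi) * exp (- x\<^sup>2 / 2)) has_real_derivative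
          1 / sqrt (2 * pi) * (- x * exp (- x\<^sup>2 / 2))) (at x)"
    by (rule derivative_eq_intros refl | simp)+
  thus ?thesis
    unfolding std_normal_density_def[abs_def] by (simp add: mult_ac)
qed

lemma std_normal_density_pos [simp]: "0 < std_normal_density x"
  by (rule normal_density_pos) simp

lemma std_normal_density_le_1: "std_normal_density x \<le> 1"
proof -
  have "1 \<le> sqrt (2 * pi)" using pi_gt3 by simp
  thus ?thesis by (auto simp: std_normal_density_def divide_simps intro: order_trans[of _ 1])
qed

lemma std_normal_density_continuous [continuous_intros]: "continuous_on A std_normal_density"
  by (intro continuous_at_imp_continuous_on ballI DERIV_isCont[OF std_normal_density_deriv])

lemma std_normal_cdf_deriv:
  "(std_normal_cdf has_real_derivative std_normal_density x) (at x)"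
proof -
  have "((\<lambda>y. integral {x-1..y} std_normal_density) has_real_derivative std_normal_density x)
          (at x within {x-1..x+1})"
    by (rule integral_has_real_derivative[OF std_normal_density_continuous]) simp
  hence "((\<lambda>y. integral {x-1..y} std_normal_density) has_real_derivative std_normal_density x) (at x)"
    by (subst (asm) at_within_interior) auto
  hence "((\<lambda>y. std_normal_cdf (x-1) + integral {x-1..y} std_normal_density)
          has_real_derivative std_normal_density x) (at x)"
    using DERIV_add[OF DERIV_const] by fastforce
  moreover have "eventually (\<lambda>y. y > x - 1) (nhds x)"
    using eventually_nhds_in_open[of "{x - 1<..}" x] by simp
  hence "eventually (\<lambda>y. std_normal_cdf y = std_normal_cdf (x-1) + integral {x-1..y} std_normal_density) (nhds x)"
  proof eventually_elim
    case (elim y)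
    thus ?case using std_normal_cdf_diff[of "x - 1" y] by simp
  qed
  ultimately show ?thesis
    by (rule DERIV_cong_ev[OF refl _ refl, THEN iffD2, rotated])
qed

text \<open>The density is at most 1. This later undoes a shift of the threshold at the cost of its
  length.\<close>

lemma std_normal_cdf_lipschitz:
  assumes "a \<le> b"
  shows "std_normal_cdf b - std_normal_cdf a \<le> b - a"
proof -
  have "b - std_normal_cdf b \<ge> a - std_normal_cdf a"
  proof (rule DERIV_nonneg_imp_nondecreasing[OF assms])
    fix x
    have "((\<lambda>x. x - std_normal_cdf x) has_real_derivative 1 - std_normal_density x) (at x)"
      by (intro DERIV_diff DERIV_ident std_normal_cdf_deriv)
    thus "\<exists>y. ((\<lambda>x. x - std_normal_cdf x) has_real_derivative y) (at x) \<and> 0 \<le> y"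
      using std_normal_density_le_1[of x] by (intro exI[of _ "1 - std_normal_density x"]) simp
  qed
  thus ?thesis by simp
qed

section \<open>Tail estimates for the normal law\<close>

lemma std_normal_density_lim: "((\<lambda>x. std_normal_density x / x) \<longlongrightarrow> 0) at_top"
proof (rule tendsto_sandwich[of "\<lambda>_. 0" _ _ "\<lambda>x. 1 / x"])
  show "eventually (\<lambda>x. 0 \<le> std_normal_density x / x) at_top"
    by (rule eventually_mono[OF eventually_gt_at_top[of 0]]) simp
  show "eventually (\<lambda>x. std_normal_density x / x \<le> 1 / x) at_top"
    by (rule eventually_mono[OF eventually_gt_at_top[of 0]])
       (simp add: divide_right_mono std_normal_density_le_1)
  show "((\<lambda>x::real. 1 / x) \<longlongrightarrow> 0) at_top"
    by (intro tendsto_divide_0[OF tendsto_const] filterlim_at_top_imp_at_infinity filterlim_ident)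
qed simp

text \<open>The density is even, so the sum of both values has derivative 0; the constant is read
  off at infinity.\<close>

lemma std_normal_cdf_minus: "std_normal_cdf (- x) = 1 - std_normal_cdf x"
proof -
  have "((\<lambda>x. std_normal_cdf (- x) + std_normal_cdf x) has_real_derivative 0) (at x)" for x
    using DERIV_add[OF DERIV_chain2[OF std_normal_cdf_deriv DERIV_minus[OF DERIV_ident]] std_normal_cdf_deriv, of x]
    by (simp add: normal_density_def)
  hence "\<exists>c. (\<lambda>y. std_normal_cdf (- y) + std_normal_cdf y) = (\<lambda>_. c)"
    using DERIV_isconst_all[of "\<lambda>y. std_normal_cdf (- y) + std_normal_cdf y"] by blast
  then obtain c where c: "(\<lambda>y. std_normal_cdf (- y) + std_normal_cdf y) = (\<lambda>_. c)" ..
  have "((\<lambda>x. std_normal_cdf (- x) + std_normal_cdf x) \<longlongrightarrow> 0 + 1) at_top"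
    by (intro tendsto_add std_normal.cdf_lim_at_top_prob
        filterlim_compose[OF std_normal.cdf_lim_at_bot filterlim_uminus_at_bot_at_top])
  hence "c = 1"
    unfolding c by (simp add: tendsto_const_iff)
  with fun_cong[OF c, of x] show ?thesis by simp
qed

text \<open>The difference of \<open>std_normal_density x / x\<close> and the upper tail has
  negative derivative and tends to 0 at infinity, hence is nonnegative.\<close>

lemma mills_ratio:
  assumes "x > 0"
  shows "x * (1 - std_normal_cdf x) \<le> std_normal_density x"
proof -
  define k where "k = (\<lambda>x. std_normal_density x / x - (1 - std_normal_cdf x))"
  have deriv: "(k has_real_derivative - (std_normal_density y / y\<^sup>2)) (at y)" if "y > 0" for y
  proof -
    have "(k has_real_derivative (- y * std_normal_density y * y - std_normal_density y * 1) / (y * y)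
             - (0 - std_normal_density y)) (at y)"
      unfolding k_def using that
      by (intro DERIV_diff DERIV_divide DERIV_const DERIV_ident std_normal_density_deriv std_normal_cdf_deriv) auto
    also have "(- y * std_normal_density y * y - std_normal_density y * 1) / (y * y)
             - (0 - std_normal_density y) = - (std_normal_density y / y\<^sup>2)"
      using that by (simp add: field_simps power2_eq_square)
    finally show ?thesis .
  qed
  have dec: "k y \<le> k x" if "x \<le> y" for y
  proof (rule DERIV_nonpos_imp_nonincreasing[OF that])
    fix u assume "x \<le> u"
    hence "u > 0" using assms by simp
    thus "\<exists>v. (k has_real_derivative v) (at u) \<and> v \<le> 0"
      by (intro exI[of _ "- (std_normal_density u / u\<^sup>2)"] conjI deriv) simp_all
  qed
  have "(k \<longlongrightarrow> 0 - (1 - 1)) at_top"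
    unfolding k_def
    by (intro tendsto_diff tendsto_const std_normal_density_lim std_normal.cdf_lim_at_top_prob)
  hence "0 \<le> k x"
    by (intro tendsto_upperbound[of k _ at_top])
       (auto intro: eventually_mono[OF eventually_ge_at_top[of x]] dec)
  thus ?thesis using assms by (simp add: k_def field_simps)
qed

lemma std_normal_cdf_nonneg [simp]: "0 \<le> std_normal_cdf x"
  and std_normal_cdf_le_1 [simp]: "std_normal_cdf x \<le> 1"
  by (simp_all add: std_normal.cdf_nonneg std_normal.cdf_bounded_prob)

text \<open>Mills' inequality on the right half-line, symmetry on the left. Divided by the density,
  this will bound \<open>w * stein_solution z w\<close>.\<close>

lemma std_normal_tails_abs:
  "\<bar>x\<bar> * (std_normal_cdf x * (1 - std_normal_cdf x)) \<le> std_normal_density x"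
proof -
  have *: "x * (std_normal_cdf x * (1 - std_normal_cdf x)) \<le> std_normal_density x" if "x > 0" for x
  proof -
    have "x * (1 - std_normal_cdf x) * std_normal_cdf x \<le> x * (1 - std_normal_cdf x) * 1"
      using that by (intro mult_left_mono) auto
    thus ?thesis using mills_ratio[OF that] by (simp add: mult_ac)
  qed
  consider "x > 0" | "x = 0" | "x < 0" by linarith
  thus ?thesis
  proof cases
    case 3
    moreover have "std_normal_density (- x) = std_normal_density x"
      by (simp add: normal_density_def)
    ultimately show ?thesis using *[of "-x"]
      by (simp add: std_normal_cdf_minus mult_ac)
  qed (use * in auto)
qed

text \<open>Large arguments are covered by \<open>std_normal_tails_abs\<close>. On
  \<open>(-1, 1)\<close> the density is at least 1/6, by \<open>exp (-1/2) >= 1/2\<close> and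
  \<open>sqrt (2 * pi) <= 3\<close>, while \<open>p * (1 - p) <= 1/4\<close>.\<close>

lemma std_normal_tails:
  "std_normal_cdf x * (1 - std_normal_cdf x) \<le> 2 * std_normal_density x"
proof (cases "\<bar>x\<bar> \<ge> 1")
  case True
  have "1 * (std_normal_cdf x * (1 - std_normal_cdf x)) \<le> \<bar>x\<bar> * (std_normal_cdf x * (1 - std_normal_cdf x))"
    using True by (intro mult_right_mono) auto
  thus ?thesis using std_normal_tails_abs[of x] normal_density_nonneg[of 0 1 x] by linarith
next
  case False
  hence "x\<^sup>2 \<le> 1" by (simp add: abs_square_le_1)
  hence "1/2 \<le> exp (- x\<^sup>2 / 2)" using exp_ge_add_one_self[of "- x\<^sup>2 / 2"] by linarith
  moreover have "sqrt (2 * pi) \<le> 3"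
    using pi_less_4 by (intro real_le_lsqrt) auto
  ultimately have "1/6 \<le> std_normal_density x"
    by (auto simp: std_normal_density_def divide_simps)
  moreover have "std_normal_cdf x * (1 - std_normal_cdf x) \<le> 1/4"
    using zero_le_power2[of "std_normal_cdf x - 1/2"] by (simp add: power2_eq_square algebra_simps)
  ultimately show ?thesis by linarith
qed

section \<open>The Stein equation\<close>

text \<open>The bounded solution of the Stein equation \<open>f' w - w * f w = of_bool (w \<le> z) - std_normal_cdf z\<close>.\<close>

definition stein_solution :: "real \<Rightarrow> real \<Rightarrow> real" where
  "stein_solution z w = std_normal_cdf (min w z) * (1 - std_normal_cdf (max w z)) / std_normal_density w"

lemma stein_solution_nonneg [simp]: "0 \<le> stein_solution z w"
  by (simp add: stein_solution_def)

text \<open>Monotonicity of the distribution function removes \<open>z\<close>, which makes the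
  later bounds uniform in the threshold.\<close>

lemma stein_solution_le:
  "stein_solution z w \<le> std_normal_cdf w * (1 - std_normal_cdf w) / std_normal_density w"
  unfolding stein_solution_def
  by (intro divide_right_mono mult_mono) (auto simp: std_normal.cdf_nondecreasing)

lemma stein_solution_bound: "stein_solution z w \<le> 2"
proof -
  have "std_normal_cdf w * (1 - std_normal_cdf w) / std_normal_density w \<le> 2"
    using std_normal_tails[of w] by (simp add: pos_divide_le_eq)
  thus ?thesis using stein_solution_le[of z w] by linarith
qed

lemma stein_solution_abs_bound: "\<bar>w * stein_solution z w\<bar> \<le> 1"
proof -
  have "\<bar>w\<bar> * (std_normal_cdf w * (1 - std_normal_cdf w) / std_normal_density w) \<le> 1"
    using std_normal_tails_abs[of w] by (simp add: pos_divide_le_eq)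
  moreover have "\<bar>w\<bar> * stein_solution z w \<le> \<bar>w\<bar> * (std_normal_cdf w * (1 - std_normal_cdf w) / std_normal_density w)"
    by (intro mult_left_mono stein_solution_le) auto
  ultimately have "\<bar>w\<bar> * stein_solution z w \<le> 1" by linarith
  thus ?thesis by (simp add: abs_mult)
qed

text \<open>The reciprocal of the density is the integrating factor of the Stein equation:
  \<open>f = u / std_normal_density\<close> solves
  \<open>f' - w * f = u' / std_normal_density\<close>.\<close>

lemma deriv_divide_std_normal_density:
  assumes "(u has_real_derivative u') (at w)"
  shows "((\<lambda>w. u w / std_normal_density w) has_real_derivative
            w * (u w / std_normal_density w) + u' / std_normal_density w) (at w)"
proof -
  have "std_normal_density w \<noteq> 0" using std_normal_density_pos[of w] by linarith
  moreover from DERIV_divide[OF assms std_normal_density_deriv this]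
  have "((\<lambda>w. u w / std_normal_density w) has_real_derivative
     (u' * std_normal_density w - u w * (- w * std_normal_density w)) / (std_normal_density w * std_normal_density w)) (at w)" .
  ultimately show ?thesis
    by (simp add: add_divide_distrib mult_ac add.commute)
qed

text \<open>On either side of \<open>z\<close> the \<open>min\<close> and \<open>max\<close>
  resolve, and the derivative of the numerator over the density is
  \<open>1 - std_normal_cdf z\<close> on the left and \<open>- std_normal_cdf z\<close> on the
  right.\<close>

lemma stein_solution_deriv:
  assumes "w \<noteq> z"
  shows "(stein_solution z has_real_derivative
            w * stein_solution z w + of_bool (w \<le> z) - std_normal_cdf z) (at w)"
proof (cases "w < z")
  case True
  have "((\<lambda>w. std_normal_cdf w * (1 - std_normal_cdf z)) has_real_derivative
      std_normal_density w * (1 - std_normal_cdf z)) (at w)"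
    by (rule derivative_eq_intros std_normal_cdf_deriv refl | simp)+
  from deriv_divide_std_normal_density[OF this]
  have "((\<lambda>w. std_normal_cdf w * (1 - std_normal_cdf z) / std_normal_density w) has_real_derivative
      w * stein_solution z w + of_bool (w \<le> z) - std_normal_cdf z) (at w)"
    using True std_normal_density_pos[of w] by (simp add: stein_solution_def add_diff_eq)
  moreover have "eventually (\<lambda>w. w \<in> {..<z}) (nhds w)"
    using True by (intro eventually_nhds_in_open) auto
  hence "eventually (\<lambda>w. stein_solution z w = std_normal_cdf w * (1 - std_normal_cdf z) / std_normal_density w) (nhds w)"
    by eventually_elim (auto simp: stein_solution_def min_def max_def)
  ultimately show ?thesis
    by (rule DERIV_cong_ev[OF refl _ refl, THEN iffD2, rotated])
next
  case False
  hence "z < w" using assms by simp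
  have "((\<lambda>w. std_normal_cdf z * (1 - std_normal_cdf w)) has_real_derivative
      - (std_normal_cdf z * std_normal_density w)) (at w)"
    by (rule derivative_eq_intros std_normal_cdf_deriv refl | simp)+
  from deriv_divide_std_normal_density[OF this]
  have "((\<lambda>w. std_normal_cdf z * (1 - std_normal_cdf w) / std_normal_density w) has_real_derivative
      w * stein_solution z w + of_bool (w \<le> z) - std_normal_cdf z) (at w)"
    using \<open>z < w\<close> std_normal_density_pos[of w] by (simp add: stein_solution_def add_diff_eq)
  moreover have "eventually (\<lambda>w. w \<in> {z<..}) (nhds w)"
    using \<open>z < w\<close> by (intro eventually_nhds_in_open) auto
  hence "eventually (\<lambda>w. stein_solution z w = std_normal_cdf z * (1 - std_normal_cdf w) / std_normal_density w) (nhds w)"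
    by eventually_elim (auto simp: stein_solution_def min_def max_def)
  ultimately show ?thesis
    by (rule DERIV_cong_ev[OF refl _ refl, THEN iffD2, rotated])
qed

section \<open>Regularity and increments of the Stein solution\<close>

lemma isCont_std_normal_cdf: "isCont std_normal_cdf x"
  using std_normal_cdf_deriv by (rule DERIV_isCont)

lemma stein_solution_continuous: "continuous_on A (stein_solution z)"
proof -
  have *: "continuous_on UNIV std_normal_cdf"
    by (simp add: continuous_at_imp_continuous_on isCont_std_normal_cdf)
  have "std_normal_density x \<noteq> 0" for x
    using std_normal_density_pos[of x] by linarith
  thus ?thesis
  unfolding stein_solution_def[abs_def]
  by (intro continuous_intros continuous_on_compose2[OF *]) auto
qed

text \<open>The mean value theorem applies because the kink at \<open>z\<close> is not interior. The
  indicator is constant on the open interval and keeps that value at \<open>b\<close>, but not at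
  \<open>a\<close> when \<open>a = z\<close>.\<close>

lemma stein_solution_increment_aux:
  assumes "a < b" and "b \<le> z \<or> z \<le> a"
  obtains x where "a < x" "x < b"
    "stein_solution z b - stein_solution z a
       = (b - a) * (x * stein_solution z x + of_bool (b \<le> z) - std_normal_cdf z)"
proof -
  obtain l x where x: "a < x" "x < b" "DERIV (stein_solution z) x :> l"
    "stein_solution z b - stein_solution z a = (b - a) * l"
    using MVT[OF \<open>a < b\<close>, of "stein_solution z"] stein_solution_continuous stein_solution_deriv assms
    by (metis (no_types, lifting) linorder_not_less order_less_imp_le real_differentiable_def)
  have "l = x * stein_solution z x + of_bool (x \<le> z) - std_normal_cdf z"
    using x stein_solution_deriv[of x z] assms DERIV_unique by (metis linorder_not_less order_less_imp_le)
  moreover have "x \<le> z \<longleftrightarrow> b \<le> z" using assms x by auto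
  ultimately show ?thesis using that[OF x(1,2)] x(4) by simp
qed

text \<open>By the Stein equation the derivative is at most 1 + 1 in absolute value: one from
  \<open>stein_solution_abs_bound\<close>, one from the centred indicator. An interval around
  \<open>z\<close> is split there.\<close>

lemma stein_solution_lipschitz:
  "\<bar>stein_solution z a - stein_solution z b\<bar> \<le> 2 * \<bar>a - b\<bar>"
proof -
  have *: "\<bar>stein_solution z b - stein_solution z a\<bar> \<le> 2 * (b - a)" if "a \<le> b" "b \<le> z \<or> z \<le> a" for a b
  proof (cases "a = b")
    case False
    hence "a < b" using that by simp
    obtain x where x: "stein_solution z b - stein_solution z a
       = (b - a) * (x * stein_solution z x + of_bool (b \<le> z) - std_normal_cdf z)"
      using stein_solution_increment_aux[OF \<open>a < b\<close> \<open>b \<le> z \<or> z \<le> a\<close>] by blast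
    have "\<bar>of_bool (b \<le> z) - std_normal_cdf z\<bar> \<le> 1"
      using std_normal_cdf_nonneg[of z] std_normal_cdf_le_1[of z] by (cases "b \<le> z") auto
    hence "\<bar>x * stein_solution z x + of_bool (b \<le> z) - std_normal_cdf z\<bar> \<le> 2"
      using stein_solution_abs_bound[of x z] by linarith
    hence "(b - a) * \<bar>x * stein_solution z x + of_bool (b \<le> z) - std_normal_cdf z\<bar> \<le> (b - a) * 2"
      using that by (intro mult_left_mono) auto
    thus ?thesis unfolding x abs_mult using that by (simp only: abs_of_nonneg mult.commute diff_ge_0_iff_ge)
  qed auto
  have **: "\<bar>stein_solution z b - stein_solution z a\<bar> \<le> 2 * (b - a)" if "a \<le> b" for a b
  proof (cases "b \<le> z \<or> z \<le> a")
    case True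
    thus ?thesis using * that by blast
  next
    case False
    have "\<bar>stein_solution z z - stein_solution z a\<bar> \<le> 2 * (z - a)"
      "\<bar>stein_solution z b - stein_solution z z\<bar> \<le> 2 * (b - z)"
      by (rule *; use \<open>\<not> (b \<le> z \<or> z \<le> a)\<close> in simp)+
    thus ?thesis by argo
  qed
  show ?thesis using **[of a b] **[of b a] by (cases "a \<le> b") (auto simp: abs_minus_commute)
qed

text \<open>Product rule for differences; size and Lipschitz constant of the solution are both at
  most 2. The linear growth in \<open>y\<close> is why a first absolute moment is estimated
  below.\<close>

lemma stein_solution_mult_diff:
  "\<bar>x * stein_solution z x - y * stein_solution z y\<bar> \<le> 2 * (1 + \<bar>y\<bar>) * \<bar>x - y\<bar>"
proof -
  have "x * stein_solution z x - y * stein_solution z y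
      = (x - y) * stein_solution z x + y * (stein_solution z x - stein_solution z y)"
    by (simp add: algebra_simps)
  also have "\<bar>\<dots>\<bar> \<le> \<bar>x - y\<bar> * stein_solution z x + \<bar>y\<bar> * \<bar>stein_solution z x - stein_solution z y\<bar>"
    by (rule order_trans[OF abs_triangle_ineq]) (simp add: abs_mult)
  also have "\<dots> \<le> \<bar>x - y\<bar> * 2 + \<bar>y\<bar> * (2 * \<bar>x - y\<bar>)"
    by (intro add_mono mult_left_mono stein_solution_bound stein_solution_lipschitz) auto
  finally show ?thesis by (simp add: algebra_simps)
qed

text \<open>In the slope at the unknown mean value point, the smooth part is moved to a
  \<open>y\<close> of choice, later either endpoint. The indicator is decreasing, so it is read at
  \<open>a\<close> in the upper and at \<open>b\<close> in the lower bound; this also covers a jump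
  inside.\<close>

lemma stein_solution_increment:
  assumes "a < b" and y: "y \<in> {a..b}"
  shows "stein_solution z b - stein_solution z a \<le>
           (b - a) * (of_bool (a \<le> z) - std_normal_cdf z + y * stein_solution z y + 2 * (1 + \<bar>y\<bar>) * (b - a))"
    and "stein_solution z b - stein_solution z a \<ge>
           (b - a) * (of_bool (b \<le> z) - std_normal_cdf z + y * stein_solution z y - 2 * (1 + \<bar>y\<bar>) * (b - a))"
proof -
  define d where "d = 2 * (1 + \<bar>y\<bar>) * (b - a)"
  have near: "\<bar>x * stein_solution z x - y * stein_solution z y\<bar> \<le> d" if "x \<in> {a..b}" for x
    unfolding d_def using that y
    by (intro order_trans[OF stein_solution_mult_diff] mult_left_mono) auto
  have *: "stein_solution z b' - stein_solution z a' \<le>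
           (b' - a') * (of_bool (a \<le> z) - std_normal_cdf z + y * stein_solution z y + d) \<and>
         stein_solution z b' - stein_solution z a' \<ge>
           (b' - a') * (of_bool (b \<le> z) - std_normal_cdf z + y * stein_solution z y - d)"
    if "a \<le> a'" "a' < b'" "b' \<le> b" "b' \<le> z \<or> z \<le> a'" for a' b'
  proof -
    obtain x where x: "a' < x" "x < b'" "stein_solution z b' - stein_solution z a'
       = (b' - a') * (x * stein_solution z x + of_bool (b' \<le> z) - std_normal_cdf z)"
      using stein_solution_increment_aux[OF \<open>a' < b'\<close> \<open>b' \<le> z \<or> z \<le> a'\<close>] by blast
    have "of_bool (b \<le> z) \<le> (of_bool (b' \<le> z) :: real)" "of_bool (b' \<le> z) \<le> (of_bool (a \<le> z) :: real)"
      using that by auto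
    moreover have "\<bar>x * stein_solution z x - y * stein_solution z y\<bar> \<le> d"
      using x that by (intro near) auto
    ultimately show ?thesis
      unfolding x(3) using \<open>a' < b'\<close> by (intro conjI mult_left_mono) linarith+
  qed
  have "stein_solution z b - stein_solution z a \<le>
           (b - a) * (of_bool (a \<le> z) - std_normal_cdf z + y * stein_solution z y + d) \<and>
         stein_solution z b - stein_solution z a \<ge>
           (b - a) * (of_bool (b \<le> z) - std_normal_cdf z + y * stein_solution z y - d)"
  proof (cases "b \<le> z \<or> z \<le> a")
    case True
    thus ?thesis using *[of a b] assms by auto
  next
    case False
    \<comment> \<open>The bounds on both sides of \<open>z\<close> add up, as they differ only in
      the interval lengths.\<close>
    thus ?thesis using *[of a z] *[of z b] by (auto simp: algebra_simps)
  qed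
  thus "stein_solution z b - stein_solution z a \<le>
           (b - a) * (of_bool (a \<le> z) - std_normal_cdf z + y * stein_solution z y + 2 * (1 + \<bar>y\<bar>) * (b - a))"
    and "stein_solution z b - stein_solution z a \<ge>
           (b - a) * (of_bool (b \<le> z) - std_normal_cdf z + y * stein_solution z y - 2 * (1 + \<bar>y\<bar>) * (b - a))"
    unfolding d_def by auto
qed

section \<open>Sums of independent Bernoulli variables\<close>

text \<open>The last summand is drawn first, so that the recursion has the same form as the one for
  \<open>random_node_depth\<close>.\<close>

primrec poisson_binomial :: "(nat \<Rightarrow> real) \<Rightarrow> nat \<Rightarrow> nat pmf" where
  "poisson_binomial q 0 = return_pmf 0"
| "poisson_binomial q (Suc n) =
     bind_pmf (bernoulli_pmf (q n)) (\<lambda>b. map_pmf (\<lambda>k. k + of_bool b) (poisson_binomial q n))"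

lemma finite_set_poisson_binomial [simp]: "finite (set_pmf (poisson_binomial q n))"
  by (induction n) auto

lemma integrable_poisson_binomial [simp]:
  fixes f :: "nat \<Rightarrow> real"
  shows "integrable (measure_pmf (poisson_binomial q n)) f"
  by (rule integrable_measure_pmf_finite) simp

lemma expectation_bounds_poisson_binomial:
  fixes f :: "nat \<Rightarrow> real"
  assumes "\<And>k. a \<le> f k" "\<And>k. f k \<le> b"
  shows "a \<le> measure_pmf.expectation (poisson_binomial q n) f"
    and "measure_pmf.expectation (poisson_binomial q n) f \<le> b"
  by (auto intro!: measure_pmf.integral_le_const measure_pmf.integral_ge_const simp: assms)

context
  fixes q :: "nat \<Rightarrow> real"
  assumes q: "\<And>i. 0 \<le> q i" "\<And>i. q i \<le> 1"
begin

abbreviation expect :: "nat \<Rightarrow> (nat \<Rightarrow> real) \<Rightarrow> real" where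
  "expect n \<equiv> measure_pmf.expectation (poisson_binomial q n)"

lemma expectation_poisson_binomial_Suc:
  "expect (Suc n) f = q n * expect n (\<lambda>k. f (Suc k)) + (1 - q n) * expect n f"
proof -
  have "expect (Suc n) f = (\<Sum>b\<in>UNIV. pmf (bernoulli_pmf (q n)) b *\<^sub>R
           measure_pmf.expectation (map_pmf (\<lambda>k. k + of_bool b) (poisson_binomial q n)) f)"
    unfolding poisson_binomial.simps
    by (rule pmf_expectation_bind) auto
  thus ?thesis by (simp add: UNIV_bool q)
qed

text \<open>
  The summation-by-parts form of the zero-bias identity: the increments of \<open>f\<close> at the sum without
  its \<open>i\<close>-th summand are controlled through \<open>g\<close> at the full sum, whichever value that summand takes.
\<close>

lemma poisson_binomial_stein_le:
  fixes f g :: "nat \<Rightarrow> real"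
  assumes "\<And>k. f (Suc k) - f k \<le> g k" "\<And>k. f (Suc k) - f k \<le> g (Suc k)"
  shows "expect n (\<lambda>k. (real k - (\<Sum>i<n. q i)) * f k) \<le> (\<Sum>i<n. q i * (1 - q i)) * expect n g"
  using assms
proof (induction n arbitrary: f g)
  case (Suc n)
  define \<mu> where "\<mu> = (\<Sum>i<n. q i)"
  define V where "V = (\<Sum>i<n. q i * (1 - q i))"
  \<comment> \<open>Conditioning on the last summand: the value 0 calls for the pair
    \<open>f\<close>, \<open>g\<close>, the value 1 for both functions shifted by one.\<close>
  have IH1: "expect n (\<lambda>k. (real k - \<mu>) * f k) \<le> V * expect n g"
    unfolding \<mu>_def V_def by (rule Suc.IH) (use Suc.prems in auto)
  have IH2: "expect n (\<lambda>k. (real k - \<mu>) * f (Suc k)) \<le> V * expect n (\<lambda>k. g (Suc k))"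
    unfolding \<mu>_def V_def by (rule Suc.IH) (use Suc.prems in auto)
  have incr: "expect n (\<lambda>k. f (Suc k) - f k) \<le> expect n g" "expect n (\<lambda>k. f (Suc k) - f k) \<le> expect n (\<lambda>k. g (Suc k))"
    by (intro integral_mono; use Suc.prems in simp)+
  have eq1: "expect n (\<lambda>k. (real (Suc k) - (\<mu> + q n)) * f (Suc k))
      = expect n (\<lambda>k. (real k - \<mu>) * f (Suc k)) + (1 - q n) * expect n (\<lambda>k. f (Suc k))"
  proof -
    have "expect n (\<lambda>k. (real (Suc k) - (\<mu> + q n)) * f (Suc k))
        = expect n (\<lambda>k. (real k - \<mu>) * f (Suc k) + (1 - q n) * f (Suc k))"
      by (intro Bochner_Integration.integral_cong) (auto simp: algebra_simps)
    thus ?thesis by simp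
  qed
  have eq2: "expect n (\<lambda>k. (real k - (\<mu> + q n)) * f k)
      = expect n (\<lambda>k. (real k - \<mu>) * f k) - q n * expect n f"
  proof -
    have "expect n (\<lambda>k. (real k - (\<mu> + q n)) * f k)
        = expect n (\<lambda>k. (real k - \<mu>) * f k - q n * f k)"
      by (intro Bochner_Integration.integral_cong) (auto simp: algebra_simps)
    thus ?thesis by simp
  qed
  \<comment> \<open>Given the value 1 the centred sum gains \<open>1 - q n\<close>, given 0 it loses
    \<open>q n\<close>; weighted, these leftovers form the variance of the last summand times a mean
    increment.\<close>
  have "expect (Suc n) (\<lambda>k. (real k - (\<mu> + q n)) * f k)
      = q n * expect n (\<lambda>k. (real k - \<mu>) * f (Suc k)) + (1 - q n) * expect n (\<lambda>k. (real k - \<mu>) * f k)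
        + q n * (1 - q n) * expect n (\<lambda>k. f (Suc k) - f k)"
    unfolding expectation_poisson_binomial_Suc eq1 eq2 by (simp add: algebra_simps)
  also have "q n * expect n (\<lambda>k. (real k - \<mu>) * f (Suc k)) \<le> q n * (V * expect n (\<lambda>k. g (Suc k)))"
    by (intro mult_left_mono IH2 q)
  also have "(1 - q n) * expect n (\<lambda>k. (real k - \<mu>) * f k) \<le> (1 - q n) * (V * expect n g)"
    by (intro mult_left_mono IH1) (use q in auto)
  \<comment> \<open>Both hypotheses are averaged with weights \<open>q n\<close> and
    \<open>1 - q n\<close>, which rebuilds the expectation of \<open>g\<close> at the full
    sum.\<close>
  also have "expect n (\<lambda>k. f (Suc k) - f k) \<le> q n * expect n (\<lambda>k. g (Suc k)) + (1 - q n) * expect n g"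
    using add_mono[OF mult_left_mono[OF incr(2) q(1)] mult_left_mono[OF incr(1), of "1 - q n"], of n] q[of n]
    by (simp add: algebra_simps)
  hence "q n * (1 - q n) * expect n (\<lambda>k. f (Suc k) - f k)
     \<le> q n * (1 - q n) * (q n * expect n (\<lambda>k. g (Suc k)) + (1 - q n) * expect n g)"
    by (intro mult_left_mono) (use q in auto)
  finally have "expect (Suc n) (\<lambda>k. (real k - (\<mu> + q n)) * f k)
     \<le> (V + q n * (1 - q n)) * (q n * expect n (\<lambda>k. g (Suc k)) + (1 - q n) * expect n g)"
    by (simp add: algebra_simps)
  thus ?case
    by (simp del: poisson_binomial.simps add: \<mu>_def V_def expectation_poisson_binomial_Suc)
qed simp

text \<open>The centred identity has all increments equal to 1, so the inequality above applies with
  constant \<open>g\<close>.\<close>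

lemma poisson_binomial_variance_le:
  "expect n (\<lambda>k. (real k - (\<Sum>i<n. q i))\<^sup>2) \<le> (\<Sum>i<n. q i * (1 - q i))"
  using poisson_binomial_stein_le[of "\<lambda>k. real k - (\<Sum>i<n. q i)" "\<lambda>_. 1" n]
  by (simp add: power2_eq_square)

text \<open>
  The centring \<open>c\<close> and the scale \<open>s\<close> need only agree with the mean and the standard deviation up to \<open>B\<close>
  as below: Stein's equation absorbs the mismatch, so no rescaling of the normal law is needed.
\<close>

context
  fixes n :: nat and \<mu> V c s B C :: real and W :: "nat \<Rightarrow> real"
  assumes \<mu>_def: "\<mu> = (\<Sum>i<n. q i)"
    and V_def: "V = (\<Sum>i<n. q i * (1 - q i))"
    and W_def: "\<And>k. W k = (real k - c) / s"
    and C_def: "C = 4 * B + 2 * (1 + B) * (4 + 2 * B + 2 * B\<^sup>2)"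
    and s: "s \<ge> 1"
    and mean: "\<bar>\<mu> - c\<bar> \<le> B"
    and var: "\<bar>V - s\<^sup>2\<bar> \<le> B"
begin

lemma poisson_binomial_variance_nonneg: "V \<ge> 0"
  unfolding V_def by (intro sum_nonneg mult_nonneg_nonneg) (use q in auto)

text \<open>The second moment controls the first. Recentring from \<open>\<mu>\<close> to
  \<open>c\<close> costs a factor 2 and a term \<open>B\<^sup>2\<close>, and the variance is at most
  \<open>s\<^sup>2 + B\<close>.\<close>

lemma poisson_binomial_first_moment_le: "expect n (\<lambda>k. \<bar>W k\<bar>) \<le> 3 + 2 * B + 2 * B\<^sup>2"
proof -
  have B: "B \<ge> 0" using mean by linarith
  have "\<bar>W k\<bar> \<le> 1 + 2 * ((real k - \<mu>)\<^sup>2 + B\<^sup>2) / s\<^sup>2" for k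
  proof -
    have "\<bar>W k\<bar> \<le> 1 + (W k)\<^sup>2"
      using zero_le_power2[of "\<bar>W k\<bar> - 1/2"] by (simp add: power2_eq_square algebra_simps abs_mult_self_eq)
    also have "(W k)\<^sup>2 = (real k - c)\<^sup>2 / s\<^sup>2"
      by (simp add: W_def power_divide)
    also have "(\<mu> - c)\<^sup>2 \<le> B\<^sup>2"
      using power_mono[OF mean, of 2] by simp
    hence "(real k - c)\<^sup>2 \<le> 2 * ((real k - \<mu>)\<^sup>2 + B\<^sup>2)"
      using zero_le_power2[of "(real k - \<mu>) - (\<mu> - c)"] by (simp add: power2_eq_square algebra_simps)
    hence "(real k - c)\<^sup>2 / s\<^sup>2 \<le> 2 * ((real k - \<mu>)\<^sup>2 + B\<^sup>2) / s\<^sup>2"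
      by (rule divide_right_mono) simp
    finally show ?thesis by simp
  qed
  hence "expect n (\<lambda>k. \<bar>W k\<bar>) \<le> expect n (\<lambda>k. 1 + 2 * ((real k - \<mu>)\<^sup>2 + B\<^sup>2) / s\<^sup>2)"
    by (intro integral_mono) auto
  also have "\<dots> = 1 + 2 * (expect n (\<lambda>k. (real k - \<mu>)\<^sup>2) + B\<^sup>2) / s\<^sup>2"
    by simp
  also have "\<dots> \<le> 1 + 2 * (s\<^sup>2 + B + B\<^sup>2) / s\<^sup>2"
    using poisson_binomial_variance_le[of n] var unfolding \<mu>_def[symmetric] V_def[symmetric]
    by (intro add_left_mono divide_right_mono mult_left_mono) auto
  also have "\<dots> = 3 + 2 * (B + B\<^sup>2) / s\<^sup>2"
    using s by (simp add: field_simps)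
  also have "2 * (B + B\<^sup>2) / s\<^sup>2 \<le> 2 * (B + B\<^sup>2) / 1"
    using s B by (intro divide_left_mono) auto
  finally show ?thesis by simp
qed

lemma poisson_binomial_variance_ratio: "\<bar>V / s\<^sup>2 - 1\<bar> \<le> B / s" "V / s\<^sup>2 \<le> 1 + B"
proof -
  have B: "B \<ge> 0" using mean by linarith
  have "s \<le> s\<^sup>2" "1 \<le> s\<^sup>2" using s self_le_power[of s 2] one_le_power[of s 2] by simp_all
  have "\<bar>V / s\<^sup>2 - 1\<bar> = \<bar>V - s\<^sup>2\<bar> / s\<^sup>2" using s by (simp add: field_simps abs_divide)
  also have "\<dots> \<le> B / s\<^sup>2" using var by (intro divide_right_mono) auto
  also have "\<dots> \<le> B / s" using \<open>s \<le> s\<^sup>2\<close> s B by (intro divide_left_mono) auto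
  finally show "\<bar>V / s\<^sup>2 - 1\<bar> \<le> B / s" .
  also have "B / s \<le> B / 1" using s B by (intro divide_left_mono) auto
  finally show "V / s\<^sup>2 \<le> 1 + B" by linarith
qed

text \<open>The factor \<open>\<epsilon> = \<plusminus>1\<close> selects the lower or the upper bound for the distribution function.\<close>

lemma poisson_binomial_stein_tail:
  assumes \<epsilon>: "\<epsilon> \<in> {1, -1 :: real}"
    and main: "\<epsilon> * expect n (\<lambda>k. (real k - \<mu>) * stein_solution z (W k))
       \<le> V * expect n (\<lambda>k. 1 / s * (\<epsilon> * (of_bool (P k) - std_normal_cdf z + W k * stein_solution z (W k))
           + 2 * (1 + \<bar>W k\<bar>) * (1 / s)))"
  shows "- (C / s) \<le> \<epsilon> * (expect n (\<lambda>k. of_bool (P k)) - std_normal_cdf z)"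
proof -
  define x where "x = expect n (\<lambda>k. W k * stein_solution z (W k))"
  define p where "p = expect n (\<lambda>k. of_bool (P k))"
  define a where "a = expect n (\<lambda>k. \<bar>W k\<bar>)"
  define T where "T = \<epsilon> * (p - std_normal_cdf z + x)"
  define Y where "Y = expect n (\<lambda>k. (real k - \<mu>) * stein_solution z (W k))"
  define F where "F = expect n (\<lambda>k. stein_solution z (W k))"
  have B: "B \<ge> 0" using mean by linarith
  \<comment> \<open>\<open>real k - c\<close> splits into \<open>real k - \<mu>\<close>, for which
    the hypothesis \<open>main\<close> is stated, and the bias \<open>\<mu> - c\<close>.\<close>
  have x_eq: "x = (Y + (\<mu> - c) * F) / s"
  proof -
    have "(Y + (\<mu> - c) * F) / s = expect n (\<lambda>k. ((real k - \<mu>) * stein_solution z (W k) + (\<mu> - c) * stein_solution z (W k)) / s)"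
      unfolding Y_def F_def by simp
    also have "\<dots> = x"
      unfolding x_def by (intro Bochner_Integration.integral_cong) (auto simp: W_def algebra_simps diff_divide_distrib add_divide_distrib)
    finally show ?thesis by simp
  qed
  have p: "0 \<le> p" "p \<le> 1"
    unfolding p_def by (rule expectation_bounds_poisson_binomial[where a = 0 and b = 1]; simp)+
  have bd: "-1 \<le> W k * stein_solution z (W k)" "W k * stein_solution z (W k) \<le> 1" for k
    using stein_solution_abs_bound[of "W k" z] by linarith+
  have "-1 \<le> x" "x \<le> 1"
    unfolding x_def
    by (rule expectation_bounds_poisson_binomial[where a = "-1" and b = 1]; simp add: bd)+
  hence x_bd: "\<bar>x\<bar> \<le> 1" by simp
  have F: "0 \<le> F" "F \<le> 2"
    unfolding F_def by (rule expectation_bounds_poisson_binomial[where a = 0 and b = 2]; simp add: stein_solution_bound)+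
  have T_bd: "\<bar>T\<bar> \<le> 2"
  proof -
    have "\<bar>p - std_normal_cdf z + x\<bar> \<le> 2"
      using p x_bd std_normal_cdf_nonneg[of z] std_normal_cdf_le_1[of z] by linarith
    thus ?thesis unfolding T_def using \<epsilon> by (auto simp: abs_mult)
  qed
  have a_bd: "a \<le> 3 + 2 * B + 2 * B\<^sup>2" unfolding a_def by (rule poisson_binomial_first_moment_le)
  have "\<epsilon> * Y \<le> V * (1 / s * (T + 2 * (1 + a) * (1 / s)))"
    using main unfolding Y_def T_def p_def x_def a_def by simp
  hence "\<epsilon> * Y / s \<le> V * (1 / s * (T + 2 * (1 + a) * (1 / s))) / s"
    using s by (intro divide_right_mono) auto
  also have "\<dots> = (V / s\<^sup>2) * T + (V / s\<^sup>2) * (2 * (1 + a) / s)"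
    by (simp add: power2_eq_square algebra_simps add_divide_distrib)
  \<comment> \<open>Replacing the variance ratio by 1 costs at most \<open>2 * B / s\<close>,
    because \<open>T\<close> is bounded by 2.\<close>
  also have "(V / s\<^sup>2) * T = T + (V / s\<^sup>2 - 1) * T" by (simp add: algebra_simps)
  also have "(V / s\<^sup>2 - 1) * T \<le> \<bar>V / s\<^sup>2 - 1\<bar> * \<bar>T\<bar>" by (metis abs_ge_self abs_mult)
  also have "\<dots> \<le> B / s * 2" using poisson_binomial_variance_ratio T_bd B s by (intro mult_mono) auto
  also have "(V / s\<^sup>2) * (2 * (1 + a) / s) \<le> (1 + B) * (2 * (4 + 2 * B + 2 * B\<^sup>2) / s)"
    using poisson_binomial_variance_ratio B s a_bd poisson_binomial_variance_nonneg
    by (intro mult_mono divide_right_mono mult_left_mono) (auto simp: a_def)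
  finally have 1: "\<epsilon> * Y / s \<le> T + B / s * 2 + (1 + B) * (2 * (4 + 2 * B + 2 * B\<^sup>2) / s)" by simp
  have "\<bar>\<epsilon> * ((\<mu> - c) * F)\<bar> \<le> B * 2"
  proof -
    have "\<bar>\<mu> - c\<bar> * \<bar>F\<bar> \<le> B * 2"
      using mean F B by (intro mult_mono) auto
    thus ?thesis using \<epsilon> by (auto simp: abs_mult)
  qed
  hence "\<epsilon> * ((\<mu> - c) * F) / s \<le> B * 2 / s"
    using s by (intro divide_right_mono) auto
  moreover have "\<epsilon> * x = \<epsilon> * Y / s + \<epsilon> * ((\<mu> - c) * F) / s"
    unfolding x_eq by (simp only: distrib_left add_divide_distrib times_divide_eq_right)
  ultimately have "\<epsilon> * x \<le> T + B / s * 2 + (1 + B) * (2 * (4 + 2 * B + 2 * B\<^sup>2) / s) + B * 2 / s"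
    using 1 by linarith
  \<comment> \<open>\<open>T\<close> contains \<open>\<epsilon> * x\<close>, which cancels and
    leaves the error of the distribution function. The three error terms sum to
    \<open>C / s\<close>.\<close>
  hence "0 \<le> \<epsilon> * (p - std_normal_cdf z) + C / s"
    unfolding T_def C_def by (simp add: algebra_simps add_divide_distrib)
  thus ?thesis by (simp add: p_def)
qed

text \<open>One more success moves \<open>W\<close> by \<open>\<delta>\<close>. The bound on an
  increment must hold with its right side read at either end of that step, so the indicator is
  shifted by \<open>\<delta>\<close>: one way for the solution, the other way for its
  negative.\<close>

lemma poisson_binomial_shifted_cdf_bounds:
  fixes z :: real
  defines "\<delta> \<equiv> 1 / s"
  shows "std_normal_cdf z - C / s \<le> expect n (\<lambda>k. of_bool (W k - \<delta> \<le> z))"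
    and "expect n (\<lambda>k. of_bool (W k + \<delta> \<le> z)) \<le> std_normal_cdf z + C / s"
proof -
  have \<delta>: "\<delta> > 0" using s by (simp add: \<delta>_def)
  have W_Suc: "W (Suc k) = W k + \<delta>" for k
    using s by (simp add: W_def \<delta>_def field_simps)
  note incr = stein_solution_increment[of "W k" "W k + \<delta>" _ z for k, OF less_add_same_cancel1[THEN iffD2, OF \<delta>], simplified add_diff_cancel_left']
  define X where "X = (\<lambda>k. W k * stein_solution z (W k))"
  define R where "R = (\<lambda>k. 2 * (1 + \<bar>W k\<bar>) * \<delta>)"
  \<comment> \<open>For \<open>j = Suc k\<close> the shifted indicator is exactly the one at
    \<open>W k\<close>; for \<open>j = k\<close> it is at least as large.\<close>
  have upper: "stein_solution z (W (Suc k)) - stein_solution z (W k) \<le> \<delta> * (of_bool (W j - \<delta> \<le> z) - std_normal_cdf z + X j + R j)"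
    if "j = k \<or> j = Suc k" for j k
  proof -
    have "stein_solution z (W (Suc k)) - stein_solution z (W k) \<le> \<delta> * (of_bool (W k \<le> z) - std_normal_cdf z + X j + R j)"
      using incr(1)[of "W j" k] that \<delta> unfolding W_Suc X_def R_def by (auto simp: W_Suc)
    also have "\<dots> \<le> \<delta> * (of_bool (W j - \<delta> \<le> z) - std_normal_cdf z + X j + R j)"
      using that \<delta> by (intro mult_left_mono add_right_mono diff_right_mono) (auto simp: W_Suc)
    finally show ?thesis .
  qed
  have lower: "stein_solution z (W (Suc k)) - stein_solution z (W k) \<ge> \<delta> * (of_bool (W j + \<delta> \<le> z) - std_normal_cdf z + X j - R j)"
    if "j = k \<or> j = Suc k" for j k
  proof -
    have "\<delta> * (of_bool (W j + \<delta> \<le> z) - std_normal_cdf z + X j - R j) \<le> \<delta> * (of_bool (W k + \<delta> \<le> z) - std_normal_cdf z + X j - R j)"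
      using that \<delta> by (intro mult_left_mono add_right_mono diff_right_mono) (auto simp: W_Suc)
    also have "\<dots> \<le> stein_solution z (W (Suc k)) - stein_solution z (W k)"
      using incr(2)[of "W j" k] that \<delta> unfolding W_Suc X_def R_def by (auto simp: W_Suc)
    finally show ?thesis .
  qed
  have "expect n (\<lambda>k. (real k - \<mu>) * stein_solution z (W k))
      \<le> V * expect n (\<lambda>k. \<delta> * (of_bool (W k - \<delta> \<le> z) - std_normal_cdf z + X k + R k))"
    unfolding \<mu>_def V_def by (rule poisson_binomial_stein_le) (use upper in blast)+
  hence "- (C / s) \<le> 1 * (expect n (\<lambda>k. of_bool (W k - \<delta> \<le> z)) - std_normal_cdf z)"
    unfolding X_def R_def \<delta>_def by (intro poisson_binomial_stein_tail) (simp_all add: algebra_simps)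
  thus "std_normal_cdf z - C / s \<le> expect n (\<lambda>k. of_bool (W k - \<delta> \<le> z))" by simp
  have "expect n (\<lambda>k. (real k - \<mu>) * (- stein_solution z (W k)))
      \<le> V * expect n (\<lambda>k. \<delta> * (- of_bool (W k + \<delta> \<le> z) + std_normal_cdf z - X k + R k))"
    unfolding \<mu>_def V_def
  proof (rule poisson_binomial_stein_le)
    fix k
    show "- stein_solution z (W (Suc k)) - - stein_solution z (W k) \<le> \<delta> * (- of_bool (W k + \<delta> \<le> z) + std_normal_cdf z - X k + R k)"
      using lower[of k k] by (simp add: algebra_simps)
    show "- stein_solution z (W (Suc k)) - - stein_solution z (W k)
        \<le> \<delta> * (- of_bool (W (Suc k) + \<delta> \<le> z) + std_normal_cdf z - X (Suc k) + R (Suc k))"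
      using lower[of "Suc k" k] by (simp add: algebra_simps)
  qed
  hence "- (C / s) \<le> (-1) * (expect n (\<lambda>k. of_bool (W k + \<delta> \<le> z)) - std_normal_cdf z)"
    unfolding X_def R_def \<delta>_def by (intro poisson_binomial_stein_tail) (simp_all add: algebra_simps)
  thus "expect n (\<lambda>k. of_bool (W k + \<delta> \<le> z)) \<le> std_normal_cdf z + C / s" by simp
qed

text \<open>The shifted bounds at \<open>z - \<delta>\<close> and \<open>z + \<delta>\<close>
  restore the threshold \<open>z\<close> for \<open>W\<close>; moving the normal law back costs
  another \<open>1 / s\<close>, the \<open>+ 1\<close> in the constant.\<close>

lemma poisson_binomial_berry_esseen:
  "\<bar>expect n (\<lambda>k. of_bool (W k \<le> z)) - std_normal_cdf z\<bar> \<le> (C + 1) / s"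
proof -
  define \<delta> where "\<delta> = 1 / s"
  have "\<delta> > 0" using s by (simp add: \<delta>_def)
  have "expect n (\<lambda>k. of_bool (W k \<le> z)) \<ge> std_normal_cdf (z - \<delta>) - C / s"
    using poisson_binomial_shifted_cdf_bounds(1)[of "z - \<delta>"] by (simp add: \<delta>_def)
  moreover have "expect n (\<lambda>k. of_bool (W k \<le> z)) \<le> std_normal_cdf (z + \<delta>) + C / s"
    using poisson_binomial_shifted_cdf_bounds(2)[of "z + \<delta>"] by (simp add: \<delta>_def)
  ultimately show ?thesis
    using std_normal_cdf_lipschitz[of z "z + \<delta>"] std_normal_cdf_lipschitz[of "z - \<delta>" z] \<open>\<delta> > 0\<close>
    by (simp add: abs_le_iff \<delta>_def add_divide_distrib)
qed

end

end

section \<open>Depths in the recursive tree\<close>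

text \<open>New nodes are adjacent to \<open>v\<close> only, so a visit to them enters and leaves
  through \<open>v\<close> and can be cut out. Ending at a new node takes at least one step from
  \<open>v\<close>, hence the strict inequality. One induction carries both cases.\<close>

lemma walk_in_attach:
  assumes E: "E \<subseteq> tree_nodes m n \<times> tree_nodes m n" and v: "v \<in> tree_nodes m n" and "n \<ge> 1" "n < l"
    and walk: "(root_node, u) \<in> (attach m l v E \<union> (attach m l v E)\<inverse>) ^^ d"
  shows "if u \<in> tree_nodes m n then \<exists>d'\<le>d. (root_node, u) \<in> (E \<union> E\<inverse>) ^^ d'
         else \<exists>d'<d. (root_node, v) \<in> (E \<union> E\<inverse>) ^^ d'"
  using walk
proof (induction d arbitrary: u)
  case 0
  thus ?case by (auto simp: tree_nodes_def)
next
  case (Suc d)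
  then obtain w where w: "(root_node, w) \<in> (attach m l v E \<union> (attach m l v E)\<inverse>) ^^ d"
    and wu: "(w, u) \<in> attach m l v E \<union> (attach m l v E)\<inverse>"
    by auto
  have new: "(l, i) \<notin> tree_nodes m n" for i
    using \<open>n \<ge> 1\<close> \<open>n < l\<close> by (auto simp: tree_nodes_def root_node_def)
  note IH = Suc.IH[OF w]
  consider "(w, u) \<in> E \<union> E\<inverse>" "w \<in> tree_nodes m n" "u \<in> tree_nodes m n"
    | "w = v" "u \<notin> tree_nodes m n" | "u = v" "w \<notin> tree_nodes m n"
    using wu E new by (auto simp: attach_def)
  thus ?case
  proof cases
    case 1
    with IH obtain d' where "d' \<le> d" "(root_node, w) \<in> (E \<union> E\<inverse>) ^^ d'" by auto
    hence "(root_node, u) \<in> (E \<union> E\<inverse>) ^^ Suc d'" "Suc d' \<le> Suc d" using 1 by auto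
    thus ?thesis using 1 by (simp only: if_True) blast
  next
    case 2
    with IH v obtain d' where "d' \<le> d" "(root_node, v) \<in> (E \<union> E\<inverse>) ^^ d'" by auto
    thus ?thesis using 2 by (auto simp: less_Suc_eq_le)
  next
    case 3
    with IH v obtain d' where "d' < d" "(root_node, v) \<in> (E \<union> E\<inverse>) ^^ d'" by auto
    thus ?thesis using 3 v by (auto intro!: exI[of _ d'])
  qed
qed

lemma depth_walk:
  assumes "E \<in> set_pmf (recursive_tree m n)" "n \<ge> 1" "u \<in> tree_nodes m n"
  shows "(root_node, u) \<in> (E \<union> E\<inverse>) ^^ depth E u"
  unfolding depth_def using depth_exists[OF assms] by (rule LeastI_ex)

lemma depth_attach_old:
  assumes E: "E \<in> set_pmf (recursive_tree m n)" and "n \<ge> 1" and v: "v \<in> tree_nodes m n" and "n < l"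
    and u: "u \<in> tree_nodes m n"
  shows "depth (attach m l v E) u = depth E u"
  unfolding depth_def[of "attach m l v E"]
proof (rule Least_equality)
  have "(E \<union> E\<inverse>) ^^ d \<subseteq> (attach m l v E \<union> (attach m l v E)\<inverse>) ^^ d" for d
    by (induction d) (auto simp: attach_def)
  thus "(root_node, u) \<in> (attach m l v E \<union> (attach m l v E)\<inverse>) ^^ depth E u"
    using depth_walk[OF E \<open>n \<ge> 1\<close> u] by blast
next
  fix d assume "(root_node, u) \<in> (attach m l v E \<union> (attach m l v E)\<inverse>) ^^ d"
  from walk_in_attach[OF recursive_tree_subset[OF E] v \<open>n \<ge> 1\<close> \<open>n < l\<close> this] u
  obtain d' where "d' \<le> d" "(root_node, u) \<in> (E \<union> E\<inverse>) ^^ d'" by auto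
  thus "depth E u \<le> d"
    unfolding depth_def by (meson Least_le order_trans)
qed

text \<open>A shortest walk to \<open>v\<close> extends by one edge, and the strict inequality in
  \<open>walk_in_attach\<close> rules out anything shorter.\<close>

lemma depth_attach_new:
  assumes E: "E \<in> set_pmf (recursive_tree m n)" and "n \<ge> 1" and v: "v \<in> tree_nodes m n" and "n < l"
    and i: "i < m"
  shows "depth (attach m l v E) (l, i) = Suc (depth E v)"
  unfolding depth_def[of "attach m l v E"]
proof (rule Least_equality)
  have "(E \<union> E\<inverse>) ^^ d \<subseteq> (attach m l v E \<union> (attach m l v E)\<inverse>) ^^ d" for d
    by (induction d) (auto simp: attach_def)
  hence "(root_node, v) \<in> (attach m l v E \<union> (attach m l v E)\<inverse>) ^^ depth E v"
    using depth_walk[OF E \<open>n \<ge> 1\<close> v] by blast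
  moreover have "(v, (l, i)) \<in> attach m l v E \<union> (attach m l v E)\<inverse>"
    using i by (simp add: attach_def)
  ultimately show "(root_node, (l, i)) \<in> (attach m l v E \<union> (attach m l v E)\<inverse>) ^^ Suc (depth E v)"
    by (rule relpow_Suc_I)
next
  fix d assume "(root_node, (l, i)) \<in> (attach m l v E \<union> (attach m l v E)\<inverse>) ^^ d"
  moreover have "(l, i) \<notin> tree_nodes m n"
    using \<open>n < l\<close> \<open>n \<ge> 1\<close> by (auto simp: tree_nodes_def root_node_def)
  ultimately obtain d' where "d' < d" "(root_node, v) \<in> (E \<union> E\<inverse>) ^^ d'"
    using walk_in_attach[OF recursive_tree_subset[OF E] v \<open>n \<ge> 1\<close> \<open>n < l\<close>] by metis
  moreover from this have "depth E v \<le> d'" unfolding depth_def by (simp add: Least_le)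
  ultimately show "Suc (depth E v) \<le> d" by simp
qed

section \<open>Law of the depth of a random node\<close>

text \<open>Unlike the depth of the newest label, this quantity satisfies a closed recursion; the
  random node is also the parent of the next label.\<close>

definition random_node_depth :: "nat \<Rightarrow> nat \<Rightarrow> nat pmf" where
  "random_node_depth m n =
     bind_pmf (recursive_tree m n) (\<lambda>E. map_pmf (depth E) (pmf_of_set (tree_nodes m n)))"

text \<open>The share of the newest label in the tree with highest label \<open>i + 2\<close>:
  \<open>m\<close> of its \<open>m * (i + 1) + 1\<close> nodes.\<close>

definition attach_prob :: "nat \<Rightarrow> nat \<Rightarrow> real" where
  "attach_prob m i = real m / (real m * real (Suc i) + 1)"

lemma attach_prob_nonneg: "0 \<le> attach_prob m i"
  by (simp add: attach_prob_def)

lemma attach_prob_le: "attach_prob m i \<le> 1 / real (Suc i)"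
proof -
  have "0 < real m * real (Suc i) + 1" by (intro add_nonneg_pos) auto
  thus ?thesis unfolding attach_prob_def by (simp only: divide_simps) (simp add: mult.commute)
qed

lemma attach_prob_le_1: "attach_prob m i \<le> 1"
  by (rule order_trans[OF attach_prob_le]) simp

text \<open>The tree is the disjoint union of \<open>m\<close> new and \<open>m * k + 1\<close> old
  nodes, so its uniform law is the mixture of theirs, weighted by their shares.\<close>

lemma pmf_of_set_tree_nodes_Suc:
  assumes "m \<ge> 1"
  shows "pmf_of_set (tree_nodes m (Suc (Suc k))) =
     bind_pmf (bernoulli_pmf (attach_prob m k))
       (\<lambda>b. if b then pmf_of_set ({Suc (Suc k)} \<times> {..<m}) else pmf_of_set (tree_nodes m (Suc k)))"
proof (rule pmf_eqI)
  fix x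
  define N where "N = {Suc (Suc k)} \<times> {..<m}"
  define T where "T = tree_nodes m (Suc k)"
  have N: "finite N" "N \<noteq> {}" "card N = m" using assms by (auto simp: N_def card_cartesian_product lessThan_empty_iff)
  have disj: "N \<inter> T = {}" by (auto simp: N_def T_def tree_nodes_def root_node_def)
  have un: "tree_nodes m (Suc (Suc k)) = N \<union> T"
    by (auto simp: N_def T_def tree_nodes_def)
  have T: "real (card T) = real m * real k + 1" "finite T" "T \<noteq> {}"
    by (simp_all add: T_def card_tree_nodes)
  have "pmf (pmf_of_set (N \<union> T)) x = (indicator N x + indicator T x) / (real m * real (Suc k) + 1)"
    using N T disj by (simp add: card_Un_disjoint indicator_add algebra_simps)
  also have "\<dots> = attach_prob m k * (indicator N x / m) + (1 - attach_prob m k) * (indicator T x / (real m * real k + 1))"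
  proof -
    define a where "a = real m * real k + 1"
    define b where "b = real m * real (Suc k) + 1"
    have pos: "a > 0" "b > 0" by (simp_all add: a_def b_def add_nonneg_pos)
    have "b = a + real m" by (simp add: a_def b_def algebra_simps)
    hence "1 - real m / b = a / b" using pos by (simp add: field_simps)
    thus ?thesis using assms pos
      unfolding attach_prob_def a_def[symmetric] b_def[symmetric] by (simp add: add_divide_distrib)
  qed
  also have "\<dots> = pmf (bind_pmf (bernoulli_pmf (attach_prob m k)) (\<lambda>b. if b then pmf_of_set N else pmf_of_set T)) x"
    using N T by (simp add: pmf_bind attach_prob_nonneg attach_prob_le_1 mult.commute)
  finally show "pmf (pmf_of_set (tree_nodes m (Suc (Suc k)))) x =
    pmf (bind_pmf (bernoulli_pmf (attach_prob m k)) (\<lambda>b. if b then pmf_of_set ({Suc (Suc k)} \<times> {..<m})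
       else pmf_of_set (tree_nodes m (Suc k)))) x"
    unfolding un N_def[symmetric] T_def[symmetric] .
qed

text \<open>A new node lies one below \<open>v\<close>, which is uniform among the old nodes; an old
  node is itself uniform among them and keeps its depth. Either way the result is a uniform old
  depth plus a coin independent of the tree.\<close>

lemma random_node_depth_Suc:
  assumes "m \<ge> 1"
  shows "random_node_depth m (Suc (Suc k)) =
     bind_pmf (bernoulli_pmf (attach_prob m k)) (\<lambda>b. map_pmf (\<lambda>d. d + of_bool b) (random_node_depth m (Suc k)))"
proof -
  let ?T = "tree_nodes m (Suc k)" and ?N = "{Suc (Suc k)} \<times> {..<m}"
  have N: "finite ?N" "?N \<noteq> {}" using assms by (auto simp: lessThan_empty_iff)
  have step: "bind_pmf (pmf_of_set ?T) (\<lambda>v. map_pmf (depth (attach m (Suc (Suc k)) v E)) (pmf_of_set (tree_nodes m (Suc (Suc k)))))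
     = bind_pmf (bernoulli_pmf (attach_prob m k)) (\<lambda>b. map_pmf (\<lambda>d. d + of_bool b) (map_pmf (depth E) (pmf_of_set ?T)))"
    if E: "E \<in> set_pmf (recursive_tree m (Suc k))" for E
  proof -
    have "bind_pmf (pmf_of_set ?T) (\<lambda>v. map_pmf (depth (attach m (Suc (Suc k)) v E)) (pmf_of_set (tree_nodes m (Suc (Suc k)))))
       = bind_pmf (pmf_of_set ?T) (\<lambda>v. bind_pmf (bernoulli_pmf (attach_prob m k))
           (\<lambda>b. if b then return_pmf (Suc (depth E v)) else map_pmf (depth E) (pmf_of_set ?T)))"
    proof (rule bind_pmf_cong[OF refl])
      fix v assume "v \<in> set_pmf (pmf_of_set ?T)"
      hence v: "v \<in> ?T" by simp
      have "map_pmf (depth (attach m (Suc (Suc k)) v E)) (pmf_of_set ?N) = map_pmf (\<lambda>_. Suc (depth E v)) (pmf_of_set ?N)"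
        using N by (intro map_pmf_cong refl) (auto simp: depth_attach_new[OF E _ v])
      moreover have "map_pmf (depth (attach m (Suc (Suc k)) v E)) (pmf_of_set ?T) = map_pmf (depth E) (pmf_of_set ?T)"
        by (intro map_pmf_cong refl depth_attach_old[OF E _ v]) auto
      ultimately show "map_pmf (depth (attach m (Suc (Suc k)) v E)) (pmf_of_set (tree_nodes m (Suc (Suc k))))
        = bind_pmf (bernoulli_pmf (attach_prob m k))
           (\<lambda>b. if b then return_pmf (Suc (depth E v)) else map_pmf (depth E) (pmf_of_set ?T))"
        unfolding pmf_of_set_tree_nodes_Suc[OF assms] map_bind_pmf
        by (intro bind_pmf_cong refl) (auto simp: map_pmf_const)
    qed
    also have "\<dots> = bind_pmf (bernoulli_pmf (attach_prob m k)) (\<lambda>b. map_pmf (\<lambda>d. d + of_bool b) (map_pmf (depth E) (pmf_of_set ?T)))"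
      \<comment> \<open>With the coin drawn before \<open>v\<close>, the node \<open>v\<close>
        supplies the uniform old node in one case and is integrated out in the other.\<close>
      by (subst bind_commute_pmf, intro bind_pmf_cong refl)
         (auto simp: map_pmf_def bind_assoc_pmf bind_return_pmf)
    finally show ?thesis .
  qed
  have "random_node_depth m (Suc (Suc k)) = bind_pmf (recursive_tree m (Suc k)) (\<lambda>E.
     bind_pmf (pmf_of_set ?T) (\<lambda>v. map_pmf (depth (attach m (Suc (Suc k)) v E)) (pmf_of_set (tree_nodes m (Suc (Suc k))))))"
    by (simp add: random_node_depth_def bind_assoc_pmf bind_return_pmf)
  also have "\<dots> = bind_pmf (recursive_tree m (Suc k)) (\<lambda>E. bind_pmf (bernoulli_pmf (attach_prob m k))
      (\<lambda>b. map_pmf (\<lambda>d. d + of_bool b) (map_pmf (depth E) (pmf_of_set ?T))))"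
    by (intro bind_pmf_cong refl step)
  also have "\<dots> = bind_pmf (bernoulli_pmf (attach_prob m k)) (\<lambda>b. map_pmf (\<lambda>d. d + of_bool b) (random_node_depth m (Suc k)))"
    by (subst bind_commute_pmf) (simp add: random_node_depth_def map_bind_pmf)
  finally show ?thesis .
qed

lemma random_node_depth_eq:
  assumes "m \<ge> 1"
  shows "random_node_depth m (Suc k) = poisson_binomial (attach_prob m) k"
proof (induction k)
  case 0
  have "depth {} root_node = 0" unfolding depth_def by (rule Least_eq_0) simp
  moreover have "tree_nodes m (Suc 0) = {root_node}" by (auto simp: tree_nodes_def)
  ultimately show ?case
    by (simp add: random_node_depth_def bind_return_pmf pmf_of_set_singleton)
qed (simp add: random_node_depth_Suc[OF assms])

text \<open>The parent of the newest nodes is uniform in the previous tree. The label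
  \<open>k + 2\<close> thus gets \<open>k\<close> Bernoulli summands and one extra edge.\<close>

lemma label_depth_law:
  assumes "m \<ge> 1"
  shows "map_pmf (label_depth (Suc (Suc k))) (recursive_tree m (Suc (Suc k)))
           = map_pmf Suc (poisson_binomial (attach_prob m) k)"
proof -
  let ?T = "tree_nodes m (Suc k)"
  have "map_pmf (label_depth (Suc (Suc k))) (recursive_tree m (Suc (Suc k)))
    = bind_pmf (recursive_tree m (Suc k)) (\<lambda>E. map_pmf (\<lambda>v. label_depth (Suc (Suc k)) (attach m (Suc (Suc k)) v E)) (pmf_of_set ?T))"
    by (simp add: map_bind_pmf map_pmf_def bind_assoc_pmf bind_return_pmf)
  also have "\<dots> = bind_pmf (recursive_tree m (Suc k)) (\<lambda>E. map_pmf (\<lambda>v. Suc (depth E v)) (pmf_of_set ?T))"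
    using assms by (intro bind_pmf_cong map_pmf_cong refl) (auto simp: label_depth_def depth_attach_new)
  also have "\<dots> = map_pmf Suc (random_node_depth m (Suc k))"
    by (simp add: random_node_depth_def map_bind_pmf pmf.map_comp o_def)
  finally show ?thesis by (simp only: random_node_depth_eq[OF assms])
qed

section \<open>Mean and variance through harmonic numbers\<close>

lemma sum_inverse_squares_le: "(\<Sum>i<k. 1 / (real (Suc i))\<^sup>2) \<le> 2"
proof -
  \<comment> \<open>Strengthened so that the induction telescopes. As \<open>1 / real 0 = 0\<close>,
    the base case is \<open>0 <= 2\<close>, and the step from \<open>k = 0\<close> is treated
    apart.\<close>
  have "(\<Sum>i<k. 1 / (real (Suc i))\<^sup>2) \<le> 2 - 1 / real k"
  proof (induction k)
    case (Suc k)
    have "1 / (real (Suc k))\<^sup>2 \<le> 1 / real k - 1 / real (Suc k)" if "k > 0"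
      using that by (simp add: divide_simps power2_eq_square)
    with Suc show ?case by (cases "k = 0") auto
  qed simp
  thus ?thesis by (rule order_trans) simp
qed

text \<open>With \<open>x = real (Suc i)\<close> the difference is
  \<open>1 / (x * (real m * x + 1))\<close>, and \<open>real m * x + 1 >= x\<close>.\<close>

lemma attach_prob_ge:
  assumes "m \<ge> 1"
  shows "1 / real (Suc i) - attach_prob m i \<le> 1 / (real (Suc i))\<^sup>2"
proof -
  define x where "x = real (Suc i)"
  have x: "x \<ge> 1" by (simp add: x_def)
  have pos: "real m * x + 1 > 0" using x by (intro add_nonneg_pos) auto
  have "1 / x - attach_prob m i = 1 / (x * (real m * x + 1))"
    using x pos unfolding attach_prob_def x_def[symmetric] by (simp add: divide_simps)
  also have "\<dots> \<le> 1 / (x * (1 * x + 0))"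
    using x assms by (intro divide_left_mono mult_left_mono add_mono mult_right_mono mult_pos_pos pos) auto
  finally show ?thesis by (simp add: x_def power2_eq_square)
qed

lemma sum_attach_prob_harm:
  assumes "m \<ge> 1"
  shows "\<bar>(\<Sum>i<k. attach_prob m i) - harm k\<bar> \<le> 2"
proof -
  have "harm k - (\<Sum>i<k. attach_prob m i) = (\<Sum>i<k. 1 / real (Suc i) - attach_prob m i)"
    by (simp add: harm_altdef sum_subtractf inverse_eq_divide)
  moreover have "(\<Sum>i<k. 1 / real (Suc i) - attach_prob m i) \<ge> 0"
    by (intro sum_nonneg) (use attach_prob_le in \<open>simp del: of_nat_Suc\<close>)
  moreover have "(\<Sum>i<k. 1 / real (Suc i) - attach_prob m i) \<le> (\<Sum>i<k. 1 / (real (Suc i))\<^sup>2)"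
    by (intro sum_mono attach_prob_ge assms)
  ultimately show ?thesis using sum_inverse_squares_le[of k] by linarith
qed

text \<open>This sum is the mean minus the variance of the Bernoulli sum.\<close>

lemma sum_attach_prob_squares: "(\<Sum>i<k. (attach_prob m i)\<^sup>2) \<le> 2"
proof -
  have "(attach_prob m i)\<^sup>2 \<le> 1 / (real (Suc i))\<^sup>2" for i
    using power_mono[OF attach_prob_le attach_prob_nonneg, of m i 2] by (simp add: power_divide)
  hence "(\<Sum>i<k. (attach_prob m i)\<^sup>2) \<le> (\<Sum>i<k. 1 / (real (Suc i))\<^sup>2)"
    by (intro sum_mono)
  thus ?thesis using sum_inverse_squares_le[of k] by linarith
qed

text \<open>\<open>harm k - ln k\<close> decreases from its value 1 at \<open>k = 1\<close>.
  Conversely \<open>ln (k + 1) <= harm k\<close>, and passing to \<open>k + 2\<close>, the label,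
  adds at most 1.\<close>

lemma harm_minus_ln_bound:
  assumes "k \<ge> 1"
  shows "\<bar>harm k - ln (real (k + 2))\<bar> \<le> 1"
proof -
  have "harm k - ln (real k) \<le> 1"
    using euler_mascheroni_sequence_decreasing[of 1 k] assms by (simp add: harm_expand)
  moreover have "ln (real k) \<le> ln (real (k + 2))" using assms by simp
  moreover have "ln (real k + 1) \<le> harm k" by (rule ln_le_harm)
  moreover have "ln (real (k + 2)) - ln (real k + 1) \<le> 1"
  proof -
    have "ln (real (k + 2)) - ln (real k + 1) = ln (real (k + 2) / (real k + 1))"
      by (simp add: ln_div)
    also have "\<dots> \<le> real (k + 2) / (real k + 1) - 1"
      by (intro ln_le_minus_one) simp
    also have "\<dots> \<le> 1" by (simp add: divide_simps)
    finally show ?thesis .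
  qed
  ultimately show ?thesis by linarith
qed

section \<open>Convergence and its rate\<close>

text \<open>The depth is one plus the Bernoulli sum, so the sum is centred at
  \<open>ln n - 1\<close>.\<close>

lemma cdf_normalized_depth_law:
  assumes "m \<ge> 1"
  shows "cdf (normalized_depth_law m (Suc (Suc k))) z =
     measure_pmf.expectation (poisson_binomial (attach_prob m) k)
       (\<lambda>j. of_bool ((real j - (ln (real (k + 2)) - 1)) / sqrt (ln (real (k + 2))) \<le> z))"
proof -
  let ?n = "Suc (Suc k)"
  let ?h = "\<lambda>d. (real d - ln (real ?n)) / sqrt (ln (real ?n))"
  have "cdf (normalized_depth_law m ?n) z = measure (measure_pmf (recursive_tree m ?n)) {E. ?h (label_depth ?n E) \<le> z}"
    by (simp add: cdf_def normalized_depth_law_def measure_distr vimage_def)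
  also have "\<dots> = measure (measure_pmf (map_pmf (label_depth ?n) (recursive_tree m ?n))) {d. ?h d \<le> z}"
    by (simp only: measure_map_pmf vimage_def mem_Collect_eq)
  also have "\<dots> = measure (measure_pmf (poisson_binomial (attach_prob m) k)) {j. ?h (Suc j) \<le> z}"
    by (simp only: label_depth_law[OF assms] measure_map_pmf vimage_def mem_Collect_eq)
  also have "\<dots> = measure_pmf.expectation (poisson_binomial (attach_prob m) k) (indicator {j. ?h (Suc j) \<le> z})"
    by simp
  also have "\<dots> = measure_pmf.expectation (poisson_binomial (attach_prob m) k)
       (\<lambda>j. of_bool ((real j - (ln (real (k + 2)) - 1)) / sqrt (ln (real (k + 2))) \<le> z))"
    by (intro Bochner_Integration.integral_cong) (auto simp: indicator_def algebra_simps)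
  finally show ?thesis .
qed

lemma cdf_normalized_depth_law_error:
  assumes "m \<ge> 1" "n \<ge> 3"
  shows "\<bar>cdf (normalized_depth_law m n) z - std_normal_cdf z\<bar> \<le> 789 / sqrt (ln (real n))"
proof -
  define k where "k = n - 2"
  have k: "k \<ge> 1" "n = Suc (Suc k)" "n = k + 2" using assms by (auto simp: k_def)
  define s where "s = sqrt (ln (real n))"
  \<comment> \<open>From \<open>n >= 3\<close> on, the scale satisfies \<open>s >= 1\<close>, as the
    normal approximation requires.\<close>
  have "exp 1 \<le> real n" using exp_le assms by simp
  hence ln: "ln (real n) \<ge> 1" using assms by (subst ln_ge_iff) auto
  have s: "s \<ge> 1" "s\<^sup>2 = ln (real n)" using ln by (simp_all add: s_def)
  have "\<bar>(\<Sum>i<k. attach_prob m i) - ln (real n)\<bar> \<le> 3"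
    using sum_attach_prob_harm[OF assms(1), of k] harm_minus_ln_bound[OF k(1)] unfolding k(3)[symmetric] by linarith
  moreover have "0 \<le> (\<Sum>i<k. (attach_prob m i)\<^sup>2)" by (intro sum_nonneg) auto
  moreover have "(\<Sum>i<k. attach_prob m i * (1 - attach_prob m i)) = (\<Sum>i<k. attach_prob m i) - (\<Sum>i<k. (attach_prob m i)\<^sup>2)"
    by (simp add: algebra_simps power2_eq_square sum_subtractf)
  \<comment> \<open>The errors are \<open>3 + 1\<close> for the mean, because of the shifted centre,
    and \<open>3 + 2\<close> for the variance, because of the squares; \<open>B = 5\<close> serves
    both.\<close>
  ultimately have "\<bar>(\<Sum>i<k. attach_prob m i) - (ln (real n) - 1)\<bar> \<le> 5"
    "\<bar>(\<Sum>i<k. attach_prob m i * (1 - attach_prob m i)) - s\<^sup>2\<bar> \<le> 5"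
    unfolding s(2) using sum_attach_prob_squares[of m k] by linarith+
  \<comment> \<open>\<open>789\<close> is the value of \<open>C + 1\<close> at \<open>B = 5\<close>\<close>
  from poisson_binomial_berry_esseen[OF attach_prob_nonneg attach_prob_le_1 refl refl refl refl s(1) this]
  have "\<bar>cdf (normalized_depth_law m n) z - std_normal_cdf z\<bar> \<le> 789 / s"
    unfolding k(2) cdf_normalized_depth_law[OF assms(1)] by (simp add: s_def k)
  thus ?thesis by (simp add: s_def)
qed

text \<open>The uniform bound makes the differences bounded above, so that the real supremum is a
  genuine least upper bound.\<close>

lemma kolmogorov_dist_le:
  assumes "\<And>z. \<bar>cdf M z - cdf N z\<bar> \<le> b"
  shows "\<bar>cdf M z - cdf N z\<bar> \<le> kolmogorov_dist M N" "kolmogorov_dist M N \<le> b"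
  unfolding kolmogorov_dist_def
  using assms by (auto intro!: cSUP_upper cSUP_least bdd_aboveI2[where M = b])

theorem theorem4p2:
  fixes m :: nat
  assumes "m \<ge> 1"
  shows "weak_conv_m (normalized_depth_law m) std_normal_distribution \<and>
    (\<lambda>n. kolmogorov_dist (normalized_depth_law m n) std_normal_distribution)
      \<in> O(\<lambda>n. 1 / sqrt (ln (real n)))"
proof
  show "weak_conv_m (normalized_depth_law m) std_normal_distribution"
    unfolding weak_conv_m_def weak_conv_def
  proof (intro allI impI)
    fix z
    have "(\<lambda>n. 789 / sqrt (ln (real n))) \<longlonglongrightarrow> 0"
      by real_asymp
    moreover have "eventually (\<lambda>n. norm (cdf (normalized_depth_law m n) z - std_normal_cdf z) \<le> 789 / sqrt (ln (real n))) sequentially"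
      by (intro eventually_mono[OF eventually_ge_at_top[of 3]]) (unfold real_norm_def, rule cdf_normalized_depth_law_error[OF assms])
    ultimately have "(\<lambda>n. cdf (normalized_depth_law m n) z - std_normal_cdf z) \<longlonglongrightarrow> 0"
      by (rule Lim_null_comparison[rotated])
    thus "(\<lambda>n. cdf (normalized_depth_law m n) z) \<longlonglongrightarrow> std_normal_cdf z"
      by (rule LIM_zero_cancel)
  qed
  show "(\<lambda>n. kolmogorov_dist (normalized_depth_law m n) std_normal_distribution)
      \<in> O(\<lambda>n. 1 / sqrt (ln (real n)))"
  proof (rule bigoI[of _ 789], rule eventually_mono[OF eventually_ge_at_top[of 3]])
    fix n :: nat assume n: "n \<ge> 3"
    note * = kolmogorov_dist_le[OF cdf_normalized_depth_law_error[OF assms n]]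
    \<comment> \<open>Nonnegativity removes the norm around the distance.\<close>
    have "0 \<le> kolmogorov_dist (normalized_depth_law m n) std_normal_distribution"
      by (rule order_trans[OF abs_ge_zero *(1)[of 0]])
    thus "norm (kolmogorov_dist (normalized_depth_law m n) std_normal_distribution)
        \<le> 789 * norm (1 / sqrt (ln (real n)))"
      using *(2) n by simp
  qed
qed

end
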